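(* Consider a decision state of the safe-round algorithm with uncommitted worker set $U$ and active firm set $S$, and let $\mathcal C(U,S)=\mathcal G(U,S)$ if the state is the first step of a round and $\mathcal C(U,S)=\mathcal S(U,S)$ if it is a later step of the round. Suppose $e=(i,j)$ and $f=(r,h)$ belong to $\mathcal C(U,S)$ and have disjoint endpoints, i.e. $i\neq r$ and $j\neq h$. Then choosing $e$ followed by $f$, or $f$ followed by $e$ (both orders being admissible), commits the same two edges and reaches the same next round state.
   Context: $F$ is a finite set of firms, $W$ a finite set of workers, and $a_{ij}\ge 0$ is the value of worker $j$ to firm $i$. For $U\subseteq W$, $S\subseteq F$, let $\mathcal S(U,S)$ be the set of $(i,j)\in S\times U$ with $a_{ij}>0$, $a_{ij}=\max_{h\in U}a_{ih}$ and $a_{ij}=\max_{r\in S}a_{rj}$ (mutual-top safe edges), and let $\mathcal G(U,S)$ be the set of pairs $(r,h)\in S\times U$ with $a_{rh}>0$ attaining the maximum of $a$ over $S\times U$. Safe-round algorithm: start with all bundles $X_i=\varnothing$, $U=W$. While there are $i\in F$, $j\in U$ with $a_{ij}>0$: start a new round with $S=F$; while there are $i\in S$, $j\in U$ with $a_{ij}>0$, choose any $(i,j)$ in the admissible candidate set, which is $\mathcal G(U,S)$ at the first step of the round and $\mathcal S(U,S)$ at later steps of the round; committing $(i,j)$ means adding $j$ to $X_i$, removing $j$ from $U$ and removing $i$ from $S$. The round state consists of the committed bundles, $U$, $S$, and whether the current step is the first step of the round. *)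

theory Defs
  imports Complex_Main
begin

record ('f, 'w) round_state =
  bundles :: "'f \<Rightarrow> 'w set"
  uncommitted :: "'w set"
  active :: "'f set"
  first_step :: bool

definition safe_edges :: "('f \<Rightarrow> 'w \<Rightarrow> real) \<Rightarrow> 'w set \<Rightarrow> 'f set \<Rightarrow> ('f \<times> 'w) set" where
  "safe_edges a U S =
    {(i, j). i \<in> S \<and> j \<in> U \<and> a i j > 0 \<and> a i j = (MAX h\<in>U. a i h) \<and> a i j = (MAX r\<in>S. a r j)}"

definition global_top_edges :: "('f \<Rightarrow> 'w \<Rightarrow> real) \<Rightarrow> 'w set \<Rightarrow> 'f set \<Rightarrow> ('f \<times> 'w) set" where
  "global_top_edges a U S =
    {(r, h). r \<in> S \<and> h \<in> U \<and> a r h > 0 \<and> a r h = (MAX p\<in>S \<times> U. a (fst p) (snd p))}"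

definition candidates :: "('f \<Rightarrow> 'w \<Rightarrow> real) \<Rightarrow> ('f, 'w) round_state \<Rightarrow> ('f \<times> 'w) set" where
  "candidates a s =
    (if first_step s then global_top_edges a (uncommitted s) (active s)
     else safe_edges a (uncommitted s) (active s))"

text \<open>The guard of both while loops: of the outer one for \<open>S = F\<close>, of the inner one for the
  current active set \<open>S\<close>.\<close>

definition positive_pair :: "('f \<Rightarrow> 'w \<Rightarrow> real) \<Rightarrow> 'w set \<Rightarrow> 'f set \<Rightarrow> bool" where
  "positive_pair a U S \<longleftrightarrow> (\<exists>i\<in>S. \<exists>j\<in>U. a i j > 0)"

fun commit :: "'f \<times> 'w \<Rightarrow> ('f, 'w) round_state \<Rightarrow> ('f, 'w) round_state" where
  "commit (i, j) s =
    \<lparr>bundles = (bundles s)(i := insert j (bundles s i)),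
     uncommitted = uncommitted s - {j},
     active = active s - {i},
     first_step = False\<rparr>"

definition start_round ::
  "'f set \<Rightarrow> ('f \<Rightarrow> 'w set) \<Rightarrow> 'w set \<Rightarrow> ('f, 'w) round_state" where
  "start_round F X U = \<lparr>bundles = X, uncommitted = U, active = F, first_step = True\<rparr>"

definition chooses ::
  "('f \<Rightarrow> 'w \<Rightarrow> real) \<Rightarrow> ('f, 'w) round_state \<Rightarrow> 'f \<times> 'w \<Rightarrow> ('f, 'w) round_state \<Rightarrow> bool" where
  "chooses a s e s' \<longleftrightarrow>
    positive_pair a (uncommitted s) (active s) \<and> e \<in> candidates a s \<and> s' = commit e s"

inductive reachable ::
  "'f set \<Rightarrow> 'w set \<Rightarrow> ('f \<Rightarrow> 'w \<Rightarrow> real) \<Rightarrow> ('f, 'w) round_state \<Rightarrow> bool"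
  for F W a where
  first_round: "positive_pair a W F \<Longrightarrow> reachable F W a (start_round F (\<lambda>_. {}) W)"
| choice: "reachable F W a s \<Longrightarrow> chooses a s e s' \<Longrightarrow> reachable F W a s'"
| next_round: "reachable F W a s \<Longrightarrow> \<not> positive_pair a (uncommitted s) (active s) \<Longrightarrow>
    positive_pair a (uncommitted s) F \<Longrightarrow>
    reachable F W a (start_round F (bundles s) (uncommitted s))"

definition decision_state ::
  "'f set \<Rightarrow> 'w set \<Rightarrow> ('f \<Rightarrow> 'w \<Rightarrow> real) \<Rightarrow> ('f, 'w) round_state \<Rightarrow> bool" where
  "decision_state F W a s \<longleftrightarrow>
    reachable F W a s \<and> positive_pair a (uncommitted s) (active s)"

definition committed_edges :: "('f, 'w) round_state \<Rightarrow> ('f \<times> 'w) set" where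
  "committed_edges s = {(i, j). j \<in> bundles s i}"

end

theory Submission imports Defs begin

text \<open>Every candidate is a safe edge, and a safe edge stays safe when a disjoint edge is committed,
  because shrinking \<open>U\<close> and \<open>S\<close> only removes competitors. Commitments of disjoint edges commute, and
  neither edge was committed before because uncommitted workers lie in no bundle.\<close>

text \<open>\<open>MAX\<close> is informative only over finite nonempty sets. Finiteness is assumed,
  and membership of \<open>j\<close> in \<open>U\<close> and of \<open>i\<close> in \<open>S\<close>
  gives nonemptiness and shows that the value is attained, so only the upper bounds remain.\<close>

lemma safe_edges_iff:
  assumes "finite U" and "finite S"
  shows "(i, j) \<in> safe_edges a U S \<longleftrightarrow>
    i \<in> S \<and> j \<in> U \<and> a i j > 0 \<and> (\<forall>h\<in>U. a i h \<le> a i j) \<and> (\<forall>r\<in>S. a r j \<le> a i j)"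
proof -
  have "a i j = (MAX h\<in>U. a i h) \<longleftrightarrow> (\<forall>h\<in>U. a i h \<le> a i j)" if "j \<in> U"
    using that assms by (subst eq_Max_iff) auto
  moreover have "a i j = (MAX r\<in>S. a r j) \<longleftrightarrow> (\<forall>r\<in>S. a r j \<le> a i j)" if "i \<in> S"
    using that assms by (subst eq_Max_iff) auto
  ultimately show ?thesis
    unfolding safe_edges_def by blast
qed

lemma global_top_edges_iff:
  assumes "finite U" and "finite S"
  shows "(i, j) \<in> global_top_edges a U S \<longleftrightarrow>
    i \<in> S \<and> j \<in> U \<and> a i j > 0 \<and> (\<forall>r\<in>S. \<forall>h\<in>U. a r h \<le> a i j)"
proof -
  have "a i j = (MAX p\<in>S \<times> U. a (fst p) (snd p)) \<longleftrightarrow> (\<forall>r\<in>S. \<forall>h\<in>U. a r h \<le> a i j)"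
    if "i \<in> S" "j \<in> U"
    using that assms by (subst eq_Max_iff) (auto simp: image_iff Bex_def)
  then show ?thesis
    unfolding global_top_edges_def by blast
qed

text \<open>A maximum over all of \<open>S \<times> U\<close> is in particular a maximum of its row
  and of its column. First and later steps of a round can thus be treated alike.\<close>

lemma candidates_subset_safe_edges:
  assumes "finite (uncommitted s)" and "finite (active s)"
  shows "candidates a s \<subseteq> safe_edges a (uncommitted s) (active s)"
  using assms by (auto simp: candidates_def safe_edges_iff global_top_edges_iff)

lemma safe_edges_antimono:
  assumes "finite U" and "finite S" and "U' \<subseteq> U" and "S' \<subseteq> S"
    and "(i, j) \<in> safe_edges a U S" and "i \<in> S'" and "j \<in> U'"
  shows "(i, j) \<in> safe_edges a U' S'"
proof -
  have "finite U'" "finite S'"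
    using assms finite_subset by blast+
  with assms show ?thesis
    by (auto simp: safe_edges_iff)
qed

lemma candidates_imp_positive_pair:
  assumes "(i, j) \<in> candidates a s"
  shows "positive_pair a (uncommitted s) (active s)"
  using assms
  by (auto simp: candidates_def safe_edges_def global_top_edges_def positive_pair_def
      split: if_splits)

lemma chooses_commit_disjoint:
  assumes "finite (uncommitted s)" and "finite (active s)"
    and "(r, h) \<in> candidates a s" and "i \<noteq> r" and "j \<noteq> h"
  shows "chooses a (commit (i, j) s) (r, h) (commit (r, h) (commit (i, j) s))"
proof -
  have safe: "(r, h) \<in> safe_edges a (uncommitted s) (active s)"
    using assms candidates_subset_safe_edges by blast
  then have "r \<in> active s - {i}" "h \<in> uncommitted s - {j}"
    using assms by (auto simp: safe_edges_def)
  with safe assms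
  have "(r, h) \<in> safe_edges a (uncommitted s - {j}) (active s - {i})"
    by (blast intro: safe_edges_antimono)
  \<comment> \<open>\<open>commit\<close> clears \<open>first_step\<close>, so the second choice
    only has to be safe, even if the first one had to be globally maximal.\<close>
  then have "(r, h) \<in> candidates a (commit (i, j) s)"
    by (simp add: candidates_def)
  then show ?thesis
    \<comment> \<open>The loop guard still holds after the first commitment: \<open>(r, h)\<close>
      itself is a positive pair there.\<close>
    using candidates_imp_positive_pair by (metis chooses_def)
qed

lemma commit_commute:
  assumes "i \<noteq> r"
  shows "commit (r, h) (commit (i, j) s) = commit (i, j) (commit (r, h) s)"
  using assms by (auto simp: fun_upd_twist)

lemma committed_edges_commit:
  "committed_edges (commit e s) = insert e (committed_edges s)"
  by (cases e) (auto simp: committed_edges_def split: if_splits)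

text \<open>The inclusions supply the finiteness behind the \<open>MAX\<close> characterizations.
  Disjointness survives \<open>commit\<close> because a worker entering a bundle leaves
  \<open>uncommitted\<close> in the same move.\<close>

lemma reachable_invariant:
  assumes "reachable F W a s"
  shows "uncommitted s \<subseteq> W \<and> active s \<subseteq> F \<and> (\<forall>i. bundles s i \<inter> uncommitted s = {})"
  using assms
proof induction
  case (choice s e s')
  then show ?case
    by (cases e) (auto simp: chooses_def)
qed (auto simp: start_round_def)

theorem lemma7:
  fixes F :: "'f set" and W :: "'w set" and a :: "'f \<Rightarrow> 'w \<Rightarrow> real"
    and s :: "('f, 'w) round_state" and i r :: 'f and j h :: 'w
  assumes "finite F" and "finite W"
    and "\<And>i j. i \<in> F \<Longrightarrow> j \<in> W \<Longrightarrow> a i j \<ge> 0"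
    and "decision_state F W a s"
    and "(i, j) \<in> candidates a s" and "(r, h) \<in> candidates a s"
    and "i \<noteq> r" and "j \<noteq> h"
  shows "\<exists>s\<^sub>e s\<^sub>f t.
    chooses a s (i, j) s\<^sub>e \<and> chooses a s\<^sub>e (r, h) t \<and>
    chooses a s (r, h) s\<^sub>f \<and> chooses a s\<^sub>f (i, j) t \<and>
    committed_edges t - committed_edges s = {(i, j), (r, h)}"
proof -
  have pos: "positive_pair a (uncommitted s) (active s)"
    and inv: "uncommitted s \<subseteq> W" "active s \<subseteq> F" "\<And>i. bundles s i \<inter> uncommitted s = {}"
    using assms(4) reachable_invariant unfolding decision_state_def by blast+
  have fin: "finite (uncommitted s)" "finite (active s)"
    using inv assms(1,2) finite_subset by blast+
  \<comment> \<open>One state serves as the witness for both orders; \<open>t'\<close> rewrites it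
    for the opposite order.\<close>
  define t where "t = commit (r, h) (commit (i, j) s)"
  have t': "t = commit (i, j) (commit (r, h) s)"
    unfolding t_def using assms(7) by (rule commit_commute)
  have "chooses a s (i, j) (commit (i, j) s)" "chooses a s (r, h) (commit (r, h) s)"
    using pos assms(5,6) by (simp_all only: chooses_def simp_thms)
  moreover have "chooses a (commit (i, j) s) (r, h) t"
    unfolding t_def using fin assms(6-8) by (rule chooses_commit_disjoint)
  moreover have "chooses a (commit (r, h) s) (i, j) t"
    unfolding t' using fin assms(5) assms(7,8)[symmetric] by (rule chooses_commit_disjoint)
  moreover have "committed_edges t - committed_edges s = {(i, j), (r, h)}"
  proof -
    \<comment> \<open>Both edges must be new, since the difference would omit any edge already
      committed in \<open>s\<close>.\<close>
    have "j \<in> uncommitted s" "h \<in> uncommitted s"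
      using candidates_subset_safe_edges[OF fin] assms(5,6) by (auto simp: safe_edges_def)
    then have "(i, j) \<notin> committed_edges s" "(r, h) \<notin> committed_edges s"
      using inv(3) by (auto simp: committed_edges_def)
    then show ?thesis
      unfolding t_def committed_edges_commit by blast
  qed
  ultimately show ?thesis
    by blast
qed

end
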